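(* The generators $z_{i,j}$ of $C(SU_0(n+1))$ are partial isometries for all $1\le i,j\le n+1$.
   Context: Fix an integer $n\ge 2$. $C(SU_0(n+1))$ denotes the universal unital $C^*$-algebra generated by elements $z_{i,j}$, $1\le i,j\le n+1$, subject to the following relations (empty products are $1$): (1) $z_{i,j}z_{i,l}=0$ if $j<l$; (2) $z_{i,j}z_{k,j}=0$ if $i<k$; (3) $z_{i,l}z_{k,j}=z_{k,j}z_{i,l}$ if $i<k$ and $j<l$; (4) $z_{i,l}z_{k,j}=0$ if $i<k$, $j<l$ and $\max\{i,j\}\ge\min\{k,l\}$; (5) $z_{i,j}z_{k,l}-z_{k,l}z_{i,j}=z_{i,l}z_{k,j}$ if $i<k$, $j<l$ and $\max\{i,j\}+1=\min\{k,l\}$; (6) $z_{i,j}z_{k,l}=z_{k,l}z_{i,j}$ if $i<k$, $j<l$ and $\max\{i,j\}+1<\min\{k,l\}$; (7) $z_{1,1}z_{2,2}\cdots z_{n+1,n+1}=1$; (8) $z_{i,j}z_{r,s}^*=z_{r,s}^*z_{i,j}$ if $i\ne r$ and $j\neq s$; (9) $z_{r,s}^*=(z_{1,1}\cdots z_{s-1,s-1})(z_{s,s+1}z_{s+1,s+2}\cdots z_{r-1,r})(z_{r+1,r+1}\cdots z_{n+1,n+1})$ if $r>s$; $z_{r,s}^*=(z_{1,1}\cdots z_{r-1,r-1})(z_{r+1,r}z_{r+2,r+1}\cdots z_{s,s-1})(z_{s+1,s+1}\cdots z_{n+1,n+1})$ if $r<s$; $z_{r,r}^*=(z_{1,1}\cdots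 z_{r-1,r-1})(z_{r+1,r+1}\cdots z_{n+1,n+1})$. *)

theory Defs
  imports Complex_Main "HOL-Algebra.Module" "HOL-Algebra.Subrings"
begin

section \<open>Unital C*-algebras\<close>

definition complex_scalars :: "complex ring" where
  "complex_scalars = \<lparr>carrier = UNIV, mult = (*), one = 1, zero = 0, add = (+)\<rparr>"

record 'a star_algebra = "(complex, 'a) module" +
  star :: "'a \<Rightarrow> 'a"
  cnorm :: "'a \<Rightarrow> real"

text \<open>
  The locale \<open>algebra\<close> of HOL-Algebra is restricted to commutative algebras, so complex algebras
  are introduced as rings that are also modules over the complex numbers, with bilinear product.
  The zero algebra is admitted (it is a unital C*-algebra with \<open>1 = 0\<close>).
\<close>

locale unital_cstar_algebra = module complex_scalars A + A: ring A for A :: "'a star_algebra" (structure) +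
  assumes smult_mult_left:
      "\<lbrakk>x \<in> carrier A; y \<in> carrier A\<rbrakk> \<Longrightarrow> (c \<odot> x) \<otimes> y = c \<odot> (x \<otimes> y)"
    and smult_mult_right:
      "\<lbrakk>x \<in> carrier A; y \<in> carrier A\<rbrakk> \<Longrightarrow> x \<otimes> (c \<odot> y) = c \<odot> (x \<otimes> y)"
    and star_closed: "x \<in> carrier A \<Longrightarrow> star A x \<in> carrier A"
    and star_star: "x \<in> carrier A \<Longrightarrow> star A (star A x) = x"
    and star_add:
      "\<lbrakk>x \<in> carrier A; y \<in> carrier A\<rbrakk> \<Longrightarrow> star A (x \<oplus> y) = star A x \<oplus> star A y"
    and star_smult: "x \<in> carrier A \<Longrightarrow> star A (c \<odot> x) = cnj c \<odot> star A x"
    and star_mult: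
      "\<lbrakk>x \<in> carrier A; y \<in> carrier A\<rbrakk> \<Longrightarrow> star A (x \<otimes> y) = star A y \<otimes> star A x"
    and cnorm_nonneg: "x \<in> carrier A \<Longrightarrow> 0 \<le> cnorm A x"
    and cnorm_eq_zero: "x \<in> carrier A \<Longrightarrow> cnorm A x = 0 \<longleftrightarrow> x = \<zero>"
    and cnorm_triangle:
      "\<lbrakk>x \<in> carrier A; y \<in> carrier A\<rbrakk> \<Longrightarrow> cnorm A (x \<oplus> y) \<le> cnorm A x + cnorm A y"
    and cnorm_smult: "x \<in> carrier A \<Longrightarrow> cnorm A (c \<odot> x) = cmod c * cnorm A x"
    and cnorm_mult:
      "\<lbrakk>x \<in> carrier A; y \<in> carrier A\<rbrakk> \<Longrightarrow> cnorm A (x \<otimes> y) \<le> cnorm A x * cnorm A y"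
    and cstar_identity: "x \<in> carrier A \<Longrightarrow> cnorm A (star A x \<otimes> x) = (cnorm A x)\<^sup>2"
    and complete:
      "\<lbrakk>\<And>k. f k \<in> carrier A;
        \<forall>e>0. \<exists>M. \<forall>k\<ge>M. \<forall>m\<ge>M. cnorm A (f k \<ominus> f m) < e\<rbrakk>
       \<Longrightarrow> \<exists>x\<in>carrier A. (\<lambda>k. cnorm A (f k \<ominus> x)) \<longlonglongrightarrow> 0"

definition unital_cstar_subalgebra :: "'a set \<Rightarrow> 'a star_algebra \<Rightarrow> bool" where
  "unital_cstar_subalgebra S A \<longleftrightarrow>
     subring S A \<and>
     (\<forall>c. \<forall>x\<in>S. c \<odot>\<^bsub>A\<^esub> x \<in> S) \<and>
     (\<forall>x\<in>S. star A x \<in> S) \<and>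
     (\<forall>f x. (\<forall>k::nat. f k \<in> S) \<and> x \<in> carrier A \<and>
        (\<lambda>k. cnorm A (f k \<ominus>\<^bsub>A\<^esub> x)) \<longlonglongrightarrow> 0 \<longrightarrow> x \<in> S)"

definition generates_cstar_algebra :: "'a set \<Rightarrow> 'a star_algebra \<Rightarrow> bool" where
  "generates_cstar_algebra G A \<longleftrightarrow>
     G \<subseteq> carrier A \<and> (\<forall>S. unital_cstar_subalgebra S A \<and> G \<subseteq> S \<longrightarrow> S = carrier A)"

text \<open>Unit preservation is part of \<open>ring_hom\<close>.\<close>

definition star_hom :: "'a star_algebra \<Rightarrow> 'b star_algebra \<Rightarrow> ('a \<Rightarrow> 'b) set" where
  "star_hom A B = {\<phi> \<in> ring_hom A B.
     (\<forall>c. \<forall>x\<in>carrier A. \<phi> (c \<odot>\<^bsub>A\<^esub> x) = c \<odot>\<^bsub>B\<^esub> \<phi> x) \<and>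
     (\<forall>x\<in>carrier A. \<phi> (star A x) = star B (\<phi> x))}"

definition projection :: "'a star_algebra \<Rightarrow> 'a \<Rightarrow> bool" where
  "projection A p \<longleftrightarrow> p \<in> carrier A \<and> star A p = p \<and> p \<otimes>\<^bsub>A\<^esub> p = p"

definition partial_isometry :: "'a star_algebra \<Rightarrow> 'a \<Rightarrow> bool" where
  "partial_isometry A v \<longleftrightarrow> v \<in> carrier A \<and> projection A (star A v \<otimes>\<^bsub>A\<^esub> v)"

section \<open>The C*-algebra of \<open>SU\<^sub>0(n+1)\<close>\<close>

text \<open>Noncommutative product of \<open>f k\<close> over a list of indices, in the order of the list.\<close>

definition oprod :: "'a star_algebra \<Rightarrow> (nat \<Rightarrow> 'a) \<Rightarrow> nat list \<Rightarrow> 'a" where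
  "oprod A f ks = foldr (\<lambda>k x. f k \<otimes>\<^bsub>A\<^esub> x) ks \<one>\<^bsub>A\<^esub>"

abbreviation SU0_indices :: "nat \<Rightarrow> nat set" where
  "SU0_indices n \<equiv> {1..n+1}"

text \<open>
  A family \<open>z\<close> in a unital C*-algebra satisfying the relations of \<open>SU\<^sub>0(n+1)\<close>; only the values
  \<open>z i j\<close> with \<open>1 \<le> i, j \<le> n+1\<close> matter. Index lists are half-open: \<open>[a..<b]\<close> is \<open>a, \<dots>, b-1\<close>.
\<close>

locale SU0_relations = unital_cstar_algebra A for A :: "'a star_algebra" (structure) +
  fixes n :: nat and z :: "nat \<Rightarrow> nat \<Rightarrow> 'a"
  assumes gen_closed: "\<lbrakk>i \<in> SU0_indices n; j \<in> SU0_indices n\<rbrakk> \<Longrightarrow> z i j \<in> carrier A"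
    and rel1: "\<lbrakk>i \<in> SU0_indices n; j \<in> SU0_indices n; l \<in> SU0_indices n; j < l\<rbrakk>
      \<Longrightarrow> z i j \<otimes> z i l = \<zero>"
    and rel2: "\<lbrakk>i \<in> SU0_indices n; k \<in> SU0_indices n; j \<in> SU0_indices n; i < k\<rbrakk>
      \<Longrightarrow> z i j \<otimes> z k j = \<zero>"
    and rel3: "\<lbrakk>i \<in> SU0_indices n; k \<in> SU0_indices n; j \<in> SU0_indices n; l \<in> SU0_indices n;
        i < k; j < l\<rbrakk>
      \<Longrightarrow> z i l \<otimes> z k j = z k j \<otimes> z i l"
    and rel4: "\<lbrakk>i \<in> SU0_indices n; k \<in> SU0_indices n; j \<in> SU0_indices n; l \<in> SU0_indices n;
        i < k; j < l; max i j \<ge> min k l\<rbrakk>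
      \<Longrightarrow> z i l \<otimes> z k j = \<zero>"
    and rel5: "\<lbrakk>i \<in> SU0_indices n; k \<in> SU0_indices n; j \<in> SU0_indices n; l \<in> SU0_indices n;
        i < k; j < l; max i j + 1 = min k l\<rbrakk>
      \<Longrightarrow> z i j \<otimes> z k l \<ominus> z k l \<otimes> z i j = z i l \<otimes> z k j"
    and rel6: "\<lbrakk>i \<in> SU0_indices n; k \<in> SU0_indices n; j \<in> SU0_indices n; l \<in> SU0_indices n;
        i < k; j < l; max i j + 1 < min k l\<rbrakk>
      \<Longrightarrow> z i j \<otimes> z k l = z k l \<otimes> z i j"
    and rel7: "oprod A (\<lambda>k. z k k) [1..<n+2] = \<one>"
    and rel8: "\<lbrakk>i \<in> SU0_indices n; j \<in> SU0_indices n; r \<in> SU0_indices n; s \<in> SU0_indices n;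
        i \<noteq> r; j \<noteq> s\<rbrakk>
      \<Longrightarrow> z i j \<otimes> star A (z r s) = star A (z r s) \<otimes> z i j"
    and rel9_below: "\<lbrakk>r \<in> SU0_indices n; s \<in> SU0_indices n; r > s\<rbrakk>
      \<Longrightarrow> star A (z r s) =
        oprod A (\<lambda>k. z k k) [1..<s] \<otimes> oprod A (\<lambda>k. z k (k+1)) [s..<r]
          \<otimes> oprod A (\<lambda>k. z k k) [r+1..<n+2]"
    and rel9_above: "\<lbrakk>r \<in> SU0_indices n; s \<in> SU0_indices n; r < s\<rbrakk>
      \<Longrightarrow> star A (z r s) =
        oprod A (\<lambda>k. z k k) [1..<r] \<otimes> oprod A (\<lambda>k. z (k+1) k) [r..<s]
          \<otimes> oprod A (\<lambda>k. z k k) [s+1..<n+2]"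
    and rel9_diag: "r \<in> SU0_indices n
      \<Longrightarrow> star A (z r r) = oprod A (\<lambda>k. z k k) [1..<r] \<otimes> oprod A (\<lambda>k. z k k) [r+1..<n+2]"

text \<open>
  \<open>(A, z)\<close> is the universal unital C*-algebra on these generators and relations, i.e.
  \<open>A = C(SU\<^sub>0(n+1))\<close> with generators \<open>z\<close>, determined up to isomorphism. HOL cannot quantify over
  all types inside a definition, so the test algebras \<open>B\<close> have their carrier inside the type
  \<^typ>\<open>real\<close>, which serves merely as a set of continuum cardinality: neither the order nor
  the arithmetic of the reals is used. This loses no generality. For an arbitrary \<open>B\<close> the
  homomorphism only needs to map into the C*-subalgebra generated by the finitely many
  \<open>w i j\<close>; that subalgebra is separable, has at most continuum many elements, and so is
  isomorphic to one carried by a set of reals. The homomorphism is unique on the carrier of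
  \<open>A\<close> because \<open>A\<close> is generated by the \<open>z i j\<close> and \<open>*\<close>-homomorphisms of C*-algebras are
  norm-decreasing.
\<close>

locale C_SU0 = SU0_relations A n z for A :: "'a star_algebra" (structure) and n and z +
  assumes generated:
      "generates_cstar_algebra {z i j |i j. i \<in> SU0_indices n \<and> j \<in> SU0_indices n} A"
    and universal:
      "\<And>(B :: real star_algebra) w. SU0_relations B n w \<Longrightarrow>
         \<exists>\<phi>\<in>star_hom A B. \<forall>i\<in>SU0_indices n. \<forall>j\<in>SU0_indices n. \<phi> (z i j) = w i j"

end

theory Submission
  imports Defs
begin

text \<open>
  Fix a column \<open>r\<close> and look at its entries \<open>z i r\<close> on and above the diagonal, \<open>i \<le> r\<close>.
  Two facts hold about them.

  First, they have mutually orthogonal ranges: \<open>(z j r)\<^sup>* z i r = 0\<close> for \<open>i \<noteq> j\<close>. For \<open>j < i\<close>,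
  the formula for \<open>(z j r)\<^sup>*\<close> contains the factor \<open>z i (i-1)\<close>, and this kills every entry to its
  right in row \<open>i\<close>; the relations allow \<open>z i r\<close> to be moved next to that factor, up to a
  commutator that is killed in the same way
  (\<open>column_ranges_orthogonal_less\<close>).

  Second, \<open>\<Sum>i\<le>r. z i r (z i r)\<^sup>* = 1\<close> (\<open>column_ranges_sum\<close>). This is an unfolding of
  \<open>z 1 1 \<cdots> z (n+1) (n+1) = 1\<close>: carrying \<open>z r r\<close> to the left of all preceding diagonal entries yields
  \<open>z r r (z r r)\<^sup>*\<close>, and the exchange with \<open>z (r-1) (r-1)\<close> leaves a commutator, which is a product of the same shape
  with \<open>z (r-1) r\<close> in place of \<open>z r r\<close>; repeating the step climbs the column.

  Multiplying the second identity on the right by \<open>z j r\<close> leaves, by the first,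
  \<open>z j r (z j r)\<^sup>* z j r = z j r\<close>, so \<open>z j r\<close> is a partial isometry whenever \<open>j \<le> r\<close>. The entries
  below the diagonal follow because the relations are invariant under transposing the matrix
  \<open>z\<close> (\<open>transpose_relations\<close>).
\<close>

section \<open>Rings and C*-algebras\<close>

lemma (in abelian_group) minus_left_eq:
  assumes "a \<ominus> b = c" and "a \<in> carrier G" "b \<in> carrier G"
  shows "a = c \<oplus> b"
  using assms by (auto simp: minus_eq a_assoc l_neg)

lemma (in abelian_group) minus_right_eq:
  assumes "a \<ominus> b = c" and "a \<in> carrier G" "b \<in> carrier G"
  shows "b = a \<ominus> c"
  using assms by (auto simp: minus_eq minus_add a_assoc[symmetric] r_neg)

lemma (in unital_cstar_algebra) star_zero: "star A \<zero> = \<zero>"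
proof -
  have "star A \<zero> \<oplus> star A \<zero> = star A \<zero>"
    using star_add[OF M.zero_closed M.zero_closed] by simp
  then show ?thesis
    using M.add.l_cancel_one[OF star_closed star_closed] M.zero_closed by simp
qed

lemma (in unital_cstar_algebra) partial_isometryI:
  assumes v: "v \<in> carrier A" and eq: "v \<otimes> star A v \<otimes> v = v"
  shows "partial_isometry A v"
proof -
  have s: "star A v \<in> carrier A" using v by (rule star_closed)
  have "star A (star A v \<otimes> v) = star A v \<otimes> v"
    using v s by (simp add: star_mult star_star)
  moreover have "(star A v \<otimes> v) \<otimes> (star A v \<otimes> v) = star A v \<otimes> (v \<otimes> star A v \<otimes> v)"
    using v s by (simp add: A.m_assoc)
  ultimately show ?thesis
    using v s eq by (simp add: partial_isometry_def projection_def)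
qed

section \<open>Ordered products\<close>

lemma oprod_Nil [simp]: "oprod A f [] = \<one>\<^bsub>A\<^esub>"
  by (simp add: oprod_def)

lemma oprod_Cons [simp]: "oprod A f (k # ks) = f k \<otimes>\<^bsub>A\<^esub> oprod A f ks"
  by (simp add: oprod_def)

context unital_cstar_algebra
begin

lemma oprod_closed: "(\<And>k. k \<in> set ks \<Longrightarrow> f k \<in> carrier A) \<Longrightarrow> oprod A f ks \<in> carrier A"
  by (induction ks) auto

lemma oprod_append:
  "(\<And>k. k \<in> set (ks @ ls) \<Longrightarrow> f k \<in> carrier A)
    \<Longrightarrow> oprod A f (ks @ ls) = oprod A f ks \<otimes> oprod A f ls"
proof (induction ks)
  case Nil
  then show ?case by (simp add: oprod_closed)
next
  case (Cons k ks)
  then show ?case by (simp add: oprod_closed A.m_assoc)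
qed

lemma oprod_upt_split:
  assumes "a \<le> b" "b \<le> c" and "\<And>k. k \<in> set [a..<c] \<Longrightarrow> f k \<in> carrier A"
  shows "oprod A f [a..<c] = oprod A f [a..<b] \<otimes> oprod A f [b..<c]"
proof -
  have "[a..<c] = [a..<b] @ [b..<c]"
    using assms upt_add_eq_append[of a b "c - b"] by simp
  then show ?thesis
    using assms(3) by (metis oprod_append)
qed

lemma oprod_commute:
  assumes "x \<in> carrier A" and "\<And>k. k \<in> set ks \<Longrightarrow> f k \<in> carrier A"
    and "\<And>k. k \<in> set ks \<Longrightarrow> x \<otimes> f k = f k \<otimes> x"
  shows "x \<otimes> oprod A f ks = oprod A f ks \<otimes> x"
  using assms
proof (induction ks)
  case (Cons k ks)
  have c: "f k \<in> carrier A" "oprod A f ks \<in> carrier A"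
    using Cons.prems by (auto intro: oprod_closed)
  have "x \<otimes> oprod A f (k # ks) = (x \<otimes> f k) \<otimes> oprod A f ks"
    using c Cons.prems(1) by (simp add: A.m_assoc)
  also have "\<dots> = f k \<otimes> (x \<otimes> oprod A f ks)"
    using c Cons.prems by (simp add: A.m_assoc)
  also have "\<dots> = oprod A f (k # ks) \<otimes> x"
    using c Cons by (simp add: A.m_assoc)
  finally show ?case .
qed simp

end

section \<open>Adjoints on and above the diagonal\<close>

context SU0_relations
begin

definition diag_prod :: "nat \<Rightarrow> nat \<Rightarrow> 'a" where
  "diag_prod a b = oprod A (\<lambda>k. z k k) [a..<b]"

definition subdiag_prod :: "nat \<Rightarrow> nat \<Rightarrow> 'a" where
  "subdiag_prod a b = oprod A (\<lambda>k. z (k + 1) k) [a..<b]"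

lemma diag_prod_closed [simp]: "1 \<le> a \<Longrightarrow> b \<le> n + 2 \<Longrightarrow> diag_prod a b \<in> carrier A"
  unfolding diag_prod_def by (intro oprod_closed gen_closed) auto

lemma subdiag_prod_closed [simp]: "1 \<le> a \<Longrightarrow> b \<le> n + 1 \<Longrightarrow> subdiag_prod a b \<in> carrier A"
  unfolding subdiag_prod_def by (intro oprod_closed gen_closed) auto

lemma diag_prod_empty [simp]: "b \<le> a \<Longrightarrow> diag_prod a b = \<one>"
  and subdiag_prod_empty [simp]: "b \<le> a \<Longrightarrow> subdiag_prod a b = \<one>"
  by (simp_all add: diag_prod_def subdiag_prod_def)

lemma diag_prod_Cons: "a < b \<Longrightarrow> diag_prod a b = z a a \<otimes> diag_prod (a + 1) b"
  and subdiag_prod_Cons: "a < b \<Longrightarrow> subdiag_prod a b = z (a + 1) a \<otimes> subdiag_prod (a + 1) b"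
  by (simp_all add: diag_prod_def subdiag_prod_def upt_conv_Cons)

lemma diag_prod_split:
  "\<lbrakk>1 \<le> a; a \<le> b; b \<le> c; c \<le> n + 2\<rbrakk> \<Longrightarrow> diag_prod a c = diag_prod a b \<otimes> diag_prod b c"
  unfolding diag_prod_def by (intro oprod_upt_split gen_closed) auto

lemma subdiag_prod_split:
  "\<lbrakk>1 \<le> a; a \<le> b; b \<le> c; c \<le> n + 1\<rbrakk>
    \<Longrightarrow> subdiag_prod a c = subdiag_prod a b \<otimes> subdiag_prod b c"
  unfolding subdiag_prod_def by (intro oprod_upt_split gen_closed) auto

text \<open>
  The diagonal case of the adjoint formula is the case \<open>i = r\<close> of the other one, with an empty
  middle product; treating them as one avoids case distinctions on the diagonal below.
\<close>

lemma star_upper: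
  assumes "1 \<le> i" "i \<le> r" "r \<le> n + 1"
  shows "star A (z i r) = diag_prod 1 i \<otimes> subdiag_prod i r \<otimes> diag_prod (r + 1) (n + 2)"
proof (cases "i = r")
  case True
  then show ?thesis using assms rel9_diag[of r, folded diag_prod_def] by simp
next
  case False
  then show ?thesis
    using assms rel9_above[of i r] unfolding diag_prod_def subdiag_prod_def by simp
qed

section \<open>Orthogonality of the ranges within a column\<close>

text \<open>
  In \<open>z (j+1) j \<cdots> z i (i-1) \<cdots> z r (r-1)\<close> the factors to the right of \<open>z i (i-1)\<close> lie strictly
  below and to the left of \<open>z i l\<close>, hence commute with it, while \<open>z i (i-1) z i l = 0\<close> because
  the two factors share row \<open>i\<close>.
\<close>

lemma subdiag_prod_annihilates:
  assumes "1 \<le> j" "j < i" "i \<le> r" "r \<le> l" "l \<le> n + 1"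
  shows "subdiag_prod j r \<otimes> z i l = \<zero>"
proof -
  have c: "subdiag_prod j (i - 1) \<in> carrier A" "subdiag_prod i r \<in> carrier A"
      "z i (i - 1) \<in> carrier A" "z i l \<in> carrier A"
    using assms by (auto intro!: subdiag_prod_closed gen_closed)
  have comm: "z i l \<otimes> subdiag_prod i r = subdiag_prod i r \<otimes> z i l"
    unfolding subdiag_prod_def using assms
    by (intro oprod_commute gen_closed rel3) auto
  have kill: "z i (i - 1) \<otimes> z i l = \<zero>"
    using assms by (intro rel1) auto
  have "subdiag_prod j r = subdiag_prod j (i - 1) \<otimes> (z i (i - 1) \<otimes> subdiag_prod i r)"
    using assms subdiag_prod_split[of j "i - 1" r] subdiag_prod_Cons[of "i - 1" r] by simp
  then have "subdiag_prod j r \<otimes> z i l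
      = subdiag_prod j (i - 1) \<otimes> (z i (i - 1) \<otimes> (subdiag_prod i r \<otimes> z i l))"
    using c by (simp add: A.m_assoc)
  also have "\<dots> = subdiag_prod j (i - 1) \<otimes> ((z i (i - 1) \<otimes> z i l) \<otimes> subdiag_prod i r)"
    using c by (simp add: comm[symmetric] A.m_assoc)
  also have "\<dots> = \<zero>" using c kill by simp
  finally show ?thesis .
qed

text \<open>
  To reach the annihilating subdiagonal product, \<open>z i r\<close> first has to cross
  \<open>z (r+1) (r+1) \<cdots> z (n+1) (n+1)\<close>. Only the first of these factors may fail to commute with it, and
  the commutator starts with \<open>z i (r+1)\<close>, another entry of row \<open>i\<close>, which the subdiagonal product
  kills too.
\<close>

lemma column_ranges_orthogonal_less:
  assumes "1 \<le> j" "j < i" "i \<le> r" "r \<le> n + 1"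
  shows "star A (z j r) \<otimes> z i r = \<zero>"
proof -
  have c: "diag_prod 1 j \<in> carrier A" "subdiag_prod j r \<in> carrier A" "z i r \<in> carrier A"
      "diag_prod (r + 1) (n + 2) \<in> carrier A"
    using assms by (auto intro!: diag_prod_closed subdiag_prod_closed gen_closed)
  have kill: "subdiag_prod j r \<otimes> z i r = \<zero>"
    using assms by (intro subdiag_prod_annihilates) auto
  have "subdiag_prod j r \<otimes> (diag_prod (r + 1) (n + 2) \<otimes> z i r) = \<zero>"
  proof (cases "r = n + 1")
    case True
    then show ?thesis using c kill by simp
  next
    case False
    let ?d = "z (r + 1) (r + 1)" and ?D = "diag_prod (r + 2) (n + 2)"
    have c': "?d \<in> carrier A" "?D \<in> carrier A" "z i (r + 1) \<in> carrier A" "z (r + 1) r \<in> carrier A"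
      using False assms by (auto intro!: diag_prod_closed gen_closed)
    have D: "diag_prod (r + 1) (n + 2) = ?d \<otimes> ?D"
      using False assms diag_prod_Cons[of "r + 1" "n + 2"] by simp
    have comm: "z i r \<otimes> ?D = ?D \<otimes> z i r"
      unfolding diag_prod_def using assms by (intro oprod_commute gen_closed rel6) auto
    have "z i r \<otimes> ?d \<ominus> ?d \<otimes> z i r = z i (r + 1) \<otimes> z (r + 1) r"
      using False assms by (intro rel5) auto
    then have swap: "?d \<otimes> z i r = z i r \<otimes> ?d \<ominus> z i (r + 1) \<otimes> z (r + 1) r"
      using c c' by (intro M.minus_right_eq) auto
    have kill': "subdiag_prod j r \<otimes> z i (r + 1) = \<zero>"
      using False assms by (intro subdiag_prod_annihilates) auto
    have "subdiag_prod j r \<otimes> (?d \<otimes> z i r)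
        = subdiag_prod j r \<otimes> z i r \<otimes> ?d \<ominus> subdiag_prod j r \<otimes> z i (r + 1) \<otimes> z (r + 1) r"
      using c c' unfolding swap by (simp add: M.minus_eq A.r_distr A.r_minus A.m_assoc)
    also have "\<dots> = \<zero>" using c' kill kill' by (simp add: M.minus_eq)
    finally have *: "subdiag_prod j r \<otimes> (?d \<otimes> z i r) = \<zero>" .
    have "subdiag_prod j r \<otimes> (diag_prod (r + 1) (n + 2) \<otimes> z i r)
        = subdiag_prod j r \<otimes> (?d \<otimes> (?D \<otimes> z i r))"
      unfolding D using c c' by (simp add: A.m_assoc)
    also have "\<dots> = (subdiag_prod j r \<otimes> (?d \<otimes> z i r)) \<otimes> ?D"
      unfolding comm[symmetric] using c c' by (simp add: A.m_assoc)
    also have "\<dots> = \<zero>" using c' * by simp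
    finally show ?thesis .
  qed
  then show ?thesis
    using assms c by (simp add: star_upper A.m_assoc)
qed

lemma column_ranges_orthogonal:
  assumes "1 \<le> i" "i \<le> r" "1 \<le> j" "j \<le> r" "r \<le> n + 1" "i \<noteq> j"
  shows "star A (z i r) \<otimes> z j r = \<zero>"
proof (cases "i < j")
  case True
  then show ?thesis using assms by (intro column_ranges_orthogonal_less) auto
next
  case False
  have c: "z i r \<in> carrier A" "z j r \<in> carrier A"
    using assms by (auto intro!: gen_closed)
  have "star A (star A (z j r) \<otimes> z i r) = star A \<zero>"
    using assms False by (subst column_ranges_orthogonal_less) auto
  then show ?thesis
    using c by (simp add: star_mult star_closed star_star star_zero)
qed

section \<open>The ranges within a column add up to the identity\<close>

text \<open>
  The right-hand side interpolates between \<open>z 1 r (z 1 r)\<^sup>*\<close> at \<open>m = 1\<close> and the full diagonal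
  product at \<open>m = r\<close>. In the step from \<open>m\<close> to \<open>m + 1\<close>, the generator \<open>v = z (m+1) r\<close> commutes with
  \<open>z 1 1, \<dots>, z (m-1) (m-1)\<close>, but passing \<open>z m m\<close> produces the extra term \<open>z m r z (m+1) m\<close>. The main
  term is \<open>v v\<^sup>*\<close>, the extra one extends the subdiagonal product by one factor and so is the
  right-hand side for \<open>m\<close>.
\<close>

lemma column_partial_sum:
  assumes "1 \<le> m" "m \<le> r" "r \<le> n + 1"
  shows "(\<Oplus>i\<in>{1..m}. z i r \<otimes> star A (z i r))
    = diag_prod 1 m \<otimes> (z m r \<otimes> (subdiag_prod m r \<otimes> diag_prod (r + 1) (n + 2)))"
  using assms
proof (induction m rule: nat_induct_at_least)
  case base
  have c: "z 1 r \<in> carrier A" "subdiag_prod 1 r \<in> carrier A" "diag_prod (r + 1) (n + 2) \<in> carrier A"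
    using base by (auto intro!: diag_prod_closed subdiag_prod_closed gen_closed)
  then show ?case using base by (simp add: star_upper star_closed)
next
  case (Suc m)
  let ?E = "diag_prod (r + 1) (n + 2)" and ?F = "subdiag_prod (m + 1) r"
    and ?D = "diag_prod 1 m" and ?v = "z (m + 1) r" and ?f = "z (m + 1) m" and ?d = "z m m"
  have c: "?E \<in> carrier A" "?F \<in> carrier A" "?D \<in> carrier A" "?v \<in> carrier A"
      "?f \<in> carrier A" "?d \<in> carrier A" "z m r \<in> carrier A"
    using Suc by (auto intro!: diag_prod_closed subdiag_prod_closed gen_closed)
  have terms: "(\<lambda>i. z i r \<otimes> star A (z i r)) \<in> {1..m} \<rightarrow> carrier A"
      "?v \<otimes> star A ?v \<in> carrier A"
    using Suc by (auto intro!: gen_closed star_closed A.m_closed)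
  have F: "subdiag_prod m r = ?f \<otimes> ?F"
    using Suc subdiag_prod_Cons[of m r] by simp
  have D: "diag_prod 1 (m + 1) = ?D \<otimes> ?d"
    using Suc c diag_prod_split[of 1 m "m + 1"] diag_prod_Cons[of m "m + 1"] by simp
  have comm: "?v \<otimes> ?D = ?D \<otimes> ?v"
    unfolding diag_prod_def using Suc
    by (intro oprod_commute gen_closed rel6[symmetric]) auto
  have "?d \<otimes> ?v \<ominus> ?v \<otimes> ?d = z m r \<otimes> ?f"
    using Suc by (intro rel5) auto
  then have swap: "?d \<otimes> ?v = z m r \<otimes> ?f \<oplus> ?v \<otimes> ?d"
    using c by (intro M.minus_left_eq) auto
  have set: "{1..Suc m} = insert (m + 1) {1..m}" by auto
  have "(\<Oplus>i\<in>{1..Suc m}. z i r \<otimes> star A (z i r))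
      = ?v \<otimes> star A ?v \<oplus> (\<Oplus>i\<in>{1..m}. z i r \<otimes> star A (z i r))"
    unfolding set using terms by (subst M.finsum_insert) auto
  also have "\<dots> = ?v \<otimes> (?D \<otimes> ?d \<otimes> ?F \<otimes> ?E) \<oplus> ?D \<otimes> (z m r \<otimes> (?f \<otimes> ?F \<otimes> ?E))"
    using Suc star_upper[of "m + 1" r] unfolding D F by simp
  also have "\<dots> = (?v \<otimes> ?D) \<otimes> (?d \<otimes> (?F \<otimes> ?E)) \<oplus> ?D \<otimes> (z m r \<otimes> (?f \<otimes> (?F \<otimes> ?E)))"
    using c by (simp add: A.m_assoc)
  also have "\<dots> = ?D \<otimes> ((z m r \<otimes> ?f \<oplus> ?v \<otimes> ?d) \<otimes> (?F \<otimes> ?E))"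
    unfolding comm using c by (simp add: A.m_assoc A.l_distr A.r_distr M.a_comm)
  also have "\<dots> = diag_prod 1 (m + 1) \<otimes> (?v \<otimes> (?F \<otimes> ?E))"
    unfolding swap[symmetric] D using c by (simp add: A.m_assoc)
  finally show ?case by simp
qed

lemma column_ranges_sum:
  assumes "1 \<le> r" "r \<le> n + 1"
  shows "(\<Oplus>i\<in>{1..r}. z i r \<otimes> star A (z i r)) = \<one>"
proof -
  have c: "z r r \<in> carrier A" "diag_prod (r + 1) (n + 2) \<in> carrier A"
    using assms by (auto intro!: diag_prod_closed gen_closed)
  have "diag_prod 1 (n + 2) = diag_prod 1 r \<otimes> (z r r \<otimes> diag_prod (r + 1) (n + 2))"
    using assms diag_prod_split[of 1 r "n + 2"] diag_prod_Cons[of r "n + 2"] by simp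
  moreover have "diag_prod 1 (n + 2) = \<one>"
    using rel7 by (simp only: diag_prod_def)
  ultimately show ?thesis
    using c assms column_partial_sum[of r r] by simp
qed

section \<open>Partial isometries\<close>

lemma upper_triangle_partial_isometry:
  assumes "1 \<le> j" "j \<le> r" "r \<le> n + 1"
  shows "partial_isometry A (z j r)"
proof (rule partial_isometryI)
  show c: "z j r \<in> carrier A" using assms by (intro gen_closed) auto
  have ci: "z i r \<in> carrier A" if "i \<in> {1..r}" for i
    using that assms by (intro gen_closed) auto
  have ct: "z i r \<otimes> star A (z i r) \<otimes> z j r \<in> carrier A" if "i \<in> {1..r}" for i
    using c ci[OF that] by (simp add: star_closed)
  have "z j r = (\<Oplus>i\<in>{1..r}. z i r \<otimes> star A (z i r)) \<otimes> z j r"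
    using c assms column_ranges_sum[of r] by simp
  also have "\<dots> = (\<Oplus>i\<in>{1..r}. z i r \<otimes> star A (z i r) \<otimes> z j r)"
    using c ci by (intro A.finsum_ldistr) (auto intro!: star_closed)
  also have "\<dots> = (\<Oplus>i\<in>{1..r}. if j = i then z i r \<otimes> star A (z i r) \<otimes> z j r else \<zero>)"
  proof (intro M.finsum_cong')
    fix i assume i: "i \<in> {1..r}"
    show "z i r \<otimes> star A (z i r) \<otimes> z j r
        = (if j = i then z i r \<otimes> star A (z i r) \<otimes> z j r else \<zero>)"
      using c ci[OF i] i assms by (simp add: A.m_assoc star_closed column_ranges_orthogonal)
  qed (use ct in auto)
  also have "\<dots> = z j r \<otimes> star A (z j r) \<otimes> z j r"
    using ct assms by (intro M.add.finprod_singleton) auto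
  finally show "z j r \<otimes> star A (z j r) \<otimes> z j r = z j r" ..
qed

text \<open>
  Transposition exchanges the row and the column annihilation relations and the two off-diagonal
  adjoint formulas. In the relations about \<open>z i l z k j\<close> it reverses the order of these two
  factors, which is harmless since they commute.
\<close>

lemma transpose_relations: "SU0_relations A n (\<lambda>i j. z j i)"
proof (unfold_locales, goal_cases)
  case (1 i j) then show ?case by (intro gen_closed)
next
  case (2 i j l) then show ?case by (intro rel2)
next
  case (3 i k j) then show ?case by (intro rel1)
next
  case (4 i k j l) then show ?case by (intro rel3[symmetric])
next
  case (5 i k j l)
  then have "z j k \<otimes> z l i = \<zero>" by (intro rel4) (auto simp: max.commute min.commute)
  then show ?case using rel3[of j l i k] 5 by simp
next
  case (6 i k j l)
  then have "z j i \<otimes> z l k \<ominus> z l k \<otimes> z j i = z j k \<otimes> z l i"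
    by (intro rel5) (auto simp: max.commute min.commute)
  then show ?case using rel3[of j l i k] 6 by simp
next
  case (7 i k j l) then show ?case by (intro rel6) (auto simp: max.commute min.commute)
next
  case 8 show ?case by (rule rel7)
next
  case (9 i j r s) then show ?case by (intro rel8) auto
next
  case (10 r s) then show ?case by (intro rel9_above)
next
  case (11 r s) then show ?case by (intro rel9_below)
next
  case (12 r) then show ?case by (rule rel9_diag)
qed

end

theorem corollary4p5:
  fixes n :: nat and A :: "'a star_algebra" and z :: "nat \<Rightarrow> nat \<Rightarrow> 'a"
  assumes "n \<ge> 2"
    and "C_SU0 A n z"
  shows "\<forall>i\<in>{1..n+1}. \<forall>j\<in>{1..n+1}. partial_isometry A (z i j)"
proof (intro ballI)
  fix i j assume ij: "i \<in> {1..n+1}" "j \<in> {1..n+1}"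
  have R: "SU0_relations A n z" using assms(2) by (rule C_SU0.axioms(1))
  show "partial_isometry A (z i j)"
  proof (cases "i \<le> j")
    case True
    then show ?thesis
      using SU0_relations.upper_triangle_partial_isometry[OF R] ij by simp
  next
    case False
    then show ?thesis
      using SU0_relations.upper_triangle_partial_isometry
        [OF SU0_relations.transpose_relations[OF R], of j i] ij by simp
  qed
qed

end
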